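(* \textsc{Weak Object Reachability} in stars can be solved in $O(n^2)$ time: there is an algorithm that, given an instance with weak preferences whose social network is a star on $n$ agents, an agent $k$ and an object $o$, decides in $O(n^2)$ time whether $o$ is reachable for $k$.
   Context: An instance consists of agents $N=\{1,\dots,n\}$, objects $O=\{o_1,\dots,o_n\}$, weak preferences $\succeq_i$ (complete preorders on $O$, ties allowed) for each agent, a social network graph $G=(N,E)$ (here a star), and the initial assignment $\sigma_0(i)=o_i$. A swap exchanges the objects of two agents $i,j$ adjacent in $G$ in an assignment $\sigma$ and is allowed only if $\sigma(j)\succeq_i\sigma(i)$ and $\sigma(i)\succeq_j\sigma(j)$. An object $o$ is reachable for agent $i$ if some sequence of swaps from $\sigma_0$ yields an assignment $\sigma_t$ with $\sigma_t(i)=o$. *)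

theory Defs
  imports Complex_Main "HOL-Library.Landau_Symbols"
begin

section \<open>Instances, swaps and reachability\<close>

text \<open>
  Agents and objects are both numbered \<open>0, \<dots>, n - 1\<close>; agent \<open>i\<close> initially owns object \<open>i\<close>.
  \<open>(a, b) \<in> pref I i\<close> means that agent \<open>i\<close> weakly prefers object \<open>a\<close> to object \<open>b\<close>.
  The edges of the social network are two-element sets of agents.
\<close>

record market =
  size_of :: nat
  pref :: "nat \<Rightarrow> (nat \<times> nat) set"
  edges :: "nat set set"

definition weak_preferences :: "market \<Rightarrow> bool" where
  "weak_preferences I \<longleftrightarrow>
     (\<forall>i<size_of I. preorder_on {..<size_of I} (pref I i) \<and> total_on {..<size_of I} (pref I i))"

definition star_network :: "market \<Rightarrow> bool" where
  "star_network I \<longleftrightarrow>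
     (\<exists>c<size_of I. edges I = {{c, i} | i. i < size_of I \<and> i \<noteq> c})"

type_synonym assignment = "nat \<Rightarrow> nat"

definition swap_step :: "market \<Rightarrow> assignment \<Rightarrow> assignment \<Rightarrow> bool" where
  "swap_step I \<sigma> \<tau> \<longleftrightarrow>
     (\<exists>i<size_of I. \<exists>j<size_of I. i \<noteq> j \<and> {i, j} \<in> edges I \<and>
        (\<sigma> j, \<sigma> i) \<in> pref I i \<and> (\<sigma> i, \<sigma> j) \<in> pref I j \<and>
        \<tau> = \<sigma>(i := \<sigma> j, j := \<sigma> i))"

definition initial_assignment :: assignment where
  "initial_assignment = (\<lambda>i. i)"

definition reachable :: "market \<Rightarrow> nat \<Rightarrow> nat \<Rightarrow> bool" where
  "reachable I k a \<longleftrightarrow> (\<exists>\<sigma>. (swap_step I)\<^sup>*\<^sup>* initial_assignment \<sigma> \<and> \<sigma> k = a)"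

section \<open>Word RAM programs\<close>

text \<open>
  Structured programs for a word RAM with word length \<open>w\<close>: finitely many named registers
  (those occurring in the program) and a random-access memory. The results of arithmetic
  are reduced modulo \<open>2 ^ w\<close> (subtraction is cut off at 0), so every computed value,
  in particular every address, is a single machine word. Each operation, memory access,
  test and assignment costs one time unit.
\<close>

datatype aexp =
    Const nat
  | Reg string
  | Read aexp
  | Plus aexp aexp
  | Minus aexp aexp
  | Times aexp aexp

datatype bexp =
    Less aexp aexp
  | Equal aexp aexp
  | Neg bexp
  | Conj bexp bexp

datatype prog =
    Skip
  | Assign string aexp
  | Write aexp aexp
  | Seq prog prog
  | Cond bexp prog prog
  | Loop bexp prog

record state =
  regs :: "string \<Rightarrow> nat"
  mem :: "nat \<Rightarrow> nat"

fun aval :: "nat \<Rightarrow> aexp \<Rightarrow> state \<Rightarrow> nat" where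
  "aval w (Const m) s = m mod 2 ^ w"
| "aval w (Reg x) s = regs s x"
| "aval w (Read a) s = mem s (aval w a s)"
| "aval w (Plus a b) s = (aval w a s + aval w b s) mod 2 ^ w"
| "aval w (Minus a b) s = aval w a s - aval w b s"
| "aval w (Times a b) s = (aval w a s * aval w b s) mod 2 ^ w"

fun bval :: "nat \<Rightarrow> bexp \<Rightarrow> state \<Rightarrow> bool" where
  "bval w (Less a b) s \<longleftrightarrow> aval w a s < aval w b s"
| "bval w (Equal a b) s \<longleftrightarrow> aval w a s = aval w b s"
| "bval w (Neg b) s \<longleftrightarrow> \<not> bval w b s"
| "bval w (Conj b c) s \<longleftrightarrow> bval w b s \<and> bval w c s"

fun acost :: "aexp \<Rightarrow> nat" where
  "acost (Const m) = 1"
| "acost (Reg x) = 1"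
| "acost (Read a) = 1 + acost a"
| "acost (Plus a b) = 1 + acost a + acost b"
| "acost (Minus a b) = 1 + acost a + acost b"
| "acost (Times a b) = 1 + acost a + acost b"

fun bcost :: "bexp \<Rightarrow> nat" where
  "bcost (Less a b) = 1 + acost a + acost b"
| "bcost (Equal a b) = 1 + acost a + acost b"
| "bcost (Neg b) = 1 + bcost b"
| "bcost (Conj b c) = 1 + bcost b + bcost c"

text \<open>
  \<open>exec w P s t s'\<close>: with word length \<open>w\<close>, program \<open>P\<close> started in state \<open>s\<close> halts after exactly
  \<open>t\<close> time units in state \<open>s'\<close>.
\<close>

inductive exec :: "nat \<Rightarrow> prog \<Rightarrow> state \<Rightarrow> nat \<Rightarrow> state \<Rightarrow> bool" for w :: nat where
  Skip: "exec w Skip s 1 s"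
| Assign: "exec w (Assign x a) s (1 + acost a) (s\<lparr>regs := (regs s)(x := aval w a s)\<rparr>)"
| Write: "exec w (Write a b) s (1 + acost a + acost b)
            (s\<lparr>mem := (mem s)(aval w a s := aval w b s)\<rparr>)"
| Seq: "exec w P s t s' \<Longrightarrow> exec w Q s' t' s'' \<Longrightarrow> exec w (Seq P Q) s (t + t') s''"
| CondTrue: "bval w b s \<Longrightarrow> exec w P s t s' \<Longrightarrow> exec w (Cond b P Q) s (1 + bcost b + t) s'"
| CondFalse: "\<not> bval w b s \<Longrightarrow> exec w Q s t s' \<Longrightarrow> exec w (Cond b P Q) s (1 + bcost b + t) s'"
| LoopFalse: "\<not> bval w b s \<Longrightarrow> exec w (Loop b P) s (1 + bcost b) s"
| LoopTrue: "bval w b s \<Longrightarrow> exec w P s t s' \<Longrightarrow> exec w (Loop b P) s' t' s'' \<Longrightarrow>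
               exec w (Loop b P) s (1 + bcost b + t + t') s''"

inductive_cases SkipE: "exec w Skip s t s'"
inductive_cases AssignE: "exec w (Assign x a) s t s'"
inductive_cases WriteE: "exec w (Write a b) s t s'"
inductive_cases SeqE: "exec w (Seq P Q) s t s'"
inductive_cases CondE: "exec w (Cond b P Q) s t s'"
inductive_cases LoopE: "exec w (Loop b P) s t s'"

lemma exec_deterministic:
  "exec w P s t s' \<Longrightarrow> exec w P s u s'' \<Longrightarrow> t = u \<and> s' = s''"
proof (induction arbitrary: u s'' rule: exec.induct)
  case (Skip s)
  then show ?case by (elim SkipE) simp
next
  case (Assign x a s)
  then show ?case by (elim AssignE) simp
next
  case (Write a b s)
  then show ?case by (elim WriteE) simp
next
  case (Seq P s t s' Q t' s1)
  from Seq.prems obtain v v' r where r: "exec w P s v r" "exec w Q r v' s''" "u = v + v'"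
    by (elim SeqE)
  from Seq.IH(1)[OF r(1)] Seq.IH(2)[of v' s''] r show ?case by simp
next
  case (CondTrue b s P t s' Q)
  from CondTrue.prems CondTrue.hyps(1) obtain v where v: "exec w P s v s''" "u = 1 + bcost b + v"
    by (elim CondE) auto
  from CondTrue.IH[OF v(1)] v(2) show ?case by simp
next
  case (CondFalse b s Q t s' P)
  from CondFalse.prems CondFalse.hyps(1) obtain v where v: "exec w Q s v s''" "u = 1 + bcost b + v"
    by (elim CondE) auto
  from CondFalse.IH[OF v(1)] v(2) show ?case by simp
next
  case (LoopFalse b s P)
  from LoopFalse.prems show ?case by (rule LoopE) (use LoopFalse.hyps in simp_all)
next
  case (LoopTrue b s P t s' t' s1)
  from LoopTrue.prems obtain v v' r
    where r: "exec w P s v r" "exec w (Loop b P) r v' s''" "u = 1 + bcost b + v + v'"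
    by (rule LoopE) (use LoopTrue.hyps(1) in auto)
  from LoopTrue.IH(1)[OF r(1)] LoopTrue.IH(2)[of v' s''] r show ?case by simp
qed

section \<open>Encoding of the input\<close>

text \<open>
  The preferences of agent \<open>i\<close> are given by the rank of each object in the order of \<open>i\<close>,
  the objects tied for the first place having rank 0.
\<close>

definition rank :: "market \<Rightarrow> nat \<Rightarrow> nat \<Rightarrow> nat" where
  "rank I i a = card {b. b < size_of I \<and> (b, a) \<in> pref I i \<and> (a, b) \<notin> pref I i}"

text \<open>
  The memory contains the adjacency matrix of the social network, row by row, followed by
  the rank table, row by row; all other cells are 0. The registers hold the number of agents,
  the agent and the object in question; all other registers are 0.
\<close>

definition input_mem :: "market \<Rightarrow> nat \<Rightarrow> nat" where
  "input_mem I p =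
     (let n = size_of I in
      if p < n * n then (if {p div n, p mod n} \<in> edges I then 1 else 0)
      else if p < 2 * n * n then rank I ((p - n * n) div n) ((p - n * n) mod n)
      else 0)"

definition input_state :: "market \<Rightarrow> nat \<Rightarrow> nat \<Rightarrow> state" where
  "input_state I k a =
     \<lparr>regs = (\<lambda>_. 0)(''n'' := size_of I, ''agent'' := k, ''object'' := a), mem = input_mem I\<rparr>"

end

theory Submission
  imports Defs
begin

text \<open>
  Let \<open>c\<close> be the center and draw an arc from object \<open>x\<close> to leaf object \<open>j\<close> if the center holding
  \<open>x\<close> and leaf \<open>j\<close> holding its initial object \<open>j\<close> may swap. An object first enters the center
  from its initial owner, so the objects obtainable by the center are those reachable from \<open>c\<close>
  along arcs, and a simple path is realised by swapping with its leaves one after the other.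

  If the agent \<open>k\<close> is a leaf, let \<open>R\<close> be the set of objects reachable from \<open>c\<close> without passing
  through \<open>k\<close>. Either \<open>k\<close> receives \<open>a \<in> R\<close> in its first swap, or it first receives some
  \<open>z \<in> R\<close>, the center moves on from \<open>k\<close> to \<open>a\<close>, and finally \<open>z\<close> is swapped for \<open>a\<close>. Two
  swaps of \<open>k\<close> suffice: once \<open>k\<close> has given away an object it had received, everything that has
  passed between \<open>k\<close> and the center since its first swap is tied for the center. In the second
  case, if the path from \<open>k\<close> to \<open>a\<close> meets \<open>R\<close>, then \<open>a\<close> already lies in \<open>R\<close>; otherwise the two
  paths are disjoint and can be executed one after the other. Hence two graph searches and one
  scan for \<open>z\<close> decide the problem.
\<close>

section \<open>Reachability in stars\<close>

text \<open>The list omits the start and, if nonempty, ends with the end vertex. Along a sequence of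
  center swaps it is thus the list of leaves met, the start being what the center holds
  beforehand.\<close>

fun walk :: "('a \<Rightarrow> 'a \<Rightarrow> bool) \<Rightarrow> 'a \<Rightarrow> 'a list \<Rightarrow> 'a \<Rightarrow> bool" where
  "walk r x [] y \<longleftrightarrow> x = y"
| "walk r x (v # vs) y \<longleftrightarrow> r x v \<and> walk r v vs y"

lemma walk_append: "walk r x (us @ vs) y \<longleftrightarrow> (\<exists>v. walk r x us v \<and> walk r v vs y)"
  by (induction us arbitrary: x) auto

lemma walk_Cons_split:
  assumes "walk r x (us @ v # vs) y"
  shows "walk r x (us @ [v]) v" "walk r v vs y"
  using assms by (auto simp: walk_append)

text \<open>When a step returns to a vertex already on the simple walk, the walk is cut at the
  earlier occurrence; otherwise the vertex is appended.\<close>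

lemma rtranclp_imp_distinct_walk:
  assumes "r\<^sup>*\<^sup>* x y"
  shows "\<exists>vs. walk r x vs y \<and> distinct (x # vs)"
  using assms
proof (induction rule: rtranclp_induct)
  case base
  have "walk r x [] x \<and> distinct [x]" by simp
  then show ?case by blast
next
  case (step y z)
  then obtain vs where vs: "walk r x vs y" "distinct (x # vs)" by blast
  show ?case
  proof (cases "z \<in> set (x # vs)")
    case True
    consider "z = x" | us ws where "vs = us @ z # ws"
      using True by (metis set_ConsD split_list)
    then show ?thesis
    proof cases
      case 1
      then have "walk r x [] z \<and> distinct [x]" by simp
      then show ?thesis by blast
    next
      case 2
      then have "walk r x (us @ [z]) z" "distinct (x # us @ [z])"
        using vs walk_Cons_split(1)[of r x us z ws y] by auto
      then show ?thesis by blast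
    qed
  next
    case False
    then have "walk r x (vs @ [z]) z" "distinct (x # vs @ [z])"
      using vs step.hyps by (auto simp: walk_append)
    then show ?thesis by blast
  qed
qed

section \<open>Star instances: ranks and swaps\<close>

locale star_market =
  fixes I :: market and c :: nat
  assumes weak: "weak_preferences I"
    and center: "c < size_of I"
    and star: "edges I = {{c, i} | i. i < size_of I \<and> i \<noteq> c}"
begin

abbreviation n :: nat where "n \<equiv> size_of I"

lemma pref_refl: "i < n \<Longrightarrow> a < n \<Longrightarrow> (a, a) \<in> pref I i"
  using weak by (auto simp: weak_preferences_def preorder_on_def refl_on_def)

lemma pref_trans: "i < n \<Longrightarrow> (a, b) \<in> pref I i \<Longrightarrow> (b, d) \<in> pref I i \<Longrightarrow> (a, d) \<in> pref I i"
  using weak by (auto simp: weak_preferences_def preorder_on_def dest: transD)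

lemma pref_total: "i < n \<Longrightarrow> a < n \<Longrightarrow> b < n \<Longrightarrow> (a, b) \<in> pref I i \<or> (b, a) \<in> pref I i"
  using weak pref_refl[of i a] by (cases "a = b") (auto simp: weak_preferences_def total_on_def)

text \<open>Transitivity nests the sets of strictly better objects; if \<open>(a, b)\<close> fails,
  totality puts \<open>b\<close> itself into the difference, so the cardinalities differ strictly.
  Preferences can thus be decided by comparing table entries.\<close>

lemma rank_le_iff:
  assumes "i < n" "a < n" "b < n"
  shows "rank I i a \<le> rank I i b \<longleftrightarrow> (a, b) \<in> pref I i"
proof
  let ?better = "\<lambda>x. {y. y < n \<and> (y, x) \<in> pref I i \<and> (x, y) \<notin> pref I i}"
  have fin: "finite (?better x)" for x by simp
  { assume ab: "(a, b) \<in> pref I i"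
    have "?better a \<subseteq> ?better b"
      using ab pref_trans[OF assms(1)] by blast
    then show "rank I i a \<le> rank I i b"
      unfolding rank_def by (rule card_mono[OF fin]) }
  { assume le: "rank I i a \<le> rank I i b"
    show "(a, b) \<in> pref I i"
    proof (rule ccontr)
      assume nab: "(a, b) \<notin> pref I i"
      then have ba: "(b, a) \<in> pref I i" using pref_total assms by blast
      have "?better b \<subset> ?better a"
      proof
        show "?better b \<subseteq> ?better a" using ba pref_trans[OF assms(1)] by blast
        have "b \<in> ?better a" using nab ba assms by simp
        moreover have "b \<notin> ?better b" by simp
        ultimately show "?better b \<noteq> ?better a" by blast
      qed
      then have "rank I i b < rank I i a"
        unfolding rank_def by (rule psubset_card_mono[OF fin])
      with le show False by simp
    qed }
qed

text \<open>Every edge contains the center, so a swap is determined by its leaf.\<close>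

lemma swap_step_iff:
  "swap_step I \<sigma> \<tau> \<longleftrightarrow>
     (\<exists>j<n. j \<noteq> c \<and> (\<sigma> c, \<sigma> j) \<in> pref I j \<and> (\<sigma> j, \<sigma> c) \<in> pref I c \<and>
        \<tau> = \<sigma>(c := \<sigma> j, j := \<sigma> c))" (is "?L \<longleftrightarrow> ?R")
proof
  assume ?L
  then obtain i j where ij: "i < n" "j < n" "i \<noteq> j" "{i, j} \<in> edges I"
    "(\<sigma> j, \<sigma> i) \<in> pref I i" "(\<sigma> i, \<sigma> j) \<in> pref I j" "\<tau> = \<sigma>(i := \<sigma> j, j := \<sigma> i)"
    unfolding swap_step_def by blast
  from ij(3,4) have "i = c \<or> j = c" by (auto simp: star doubleton_eq_iff)
  then show ?R
  proof
    assume "i = c" then show ?R using ij by blast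
  next
    assume "j = c"
    moreover have "\<tau> = \<sigma>(j := \<sigma> i, i := \<sigma> j)" using ij(3,7) by (simp add: fun_upd_twist)
    ultimately show ?R using ij by blast
  qed
next
  assume ?R
  then obtain j where j: "j < n" "j \<noteq> c" "(\<sigma> c, \<sigma> j) \<in> pref I j" "(\<sigma> j, \<sigma> c) \<in> pref I c"
    "\<tau> = \<sigma>(c := \<sigma> j, j := \<sigma> c)" by blast
  moreover have "{c, j} \<in> edges I" using j by (auto simp: star)
  ultimately show ?L unfolding swap_step_def using center by metis
qed

section \<open>The digraph of swaps with untouched leaves\<close>

definition arc :: "nat \<Rightarrow> nat \<Rightarrow> bool" where
  "arc x j \<longleftrightarrow> (x, j) \<in> pref I j \<and> (j, x) \<in> pref I c"

text \<open>Only targets are restricted, so a walk may start at \<open>c\<close> or at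
  \<open>e\<close>. With \<open>e = c\<close> all leaves are allowed; with \<open>e = k\<close> leaf
  \<open>k\<close> is avoided as well.\<close>

definition hop :: "nat \<Rightarrow> nat \<Rightarrow> nat \<Rightarrow> bool" where
  "hop e x j \<longleftrightarrow> j < n \<and> j \<noteq> c \<and> j \<noteq> e \<and> arc x j"

lemma hop_less: "(hop e)\<^sup>*\<^sup>* x y \<Longrightarrow> x < n \<Longrightarrow> y < n"
  by (induction rule: rtranclp_induct) (auto simp: hop_def)

lemma hop_avoids: "(hop e)\<^sup>*\<^sup>* x y \<Longrightarrow> x \<noteq> e \<Longrightarrow> y \<noteq> e"
  by (induction rule: rtranclp_induct) (auto simp: hop_def)

lemma walk_hop_set:
  "walk (hop e) x vs y \<Longrightarrow> v \<in> set vs \<Longrightarrow> v < n \<and> v \<noteq> c \<and> v \<noteq> e \<and> (hop e)\<^sup>*\<^sup>* x v"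
proof (induction vs arbitrary: x)
  case (Cons u vs)
  then have u: "hop e x u" "walk (hop e) u vs y" by simp_all
  then have "u < n \<and> u \<noteq> c \<and> u \<noteq> e" by (simp add: hop_def)
  with u Cons.IH[OF u(2)] Cons.prems(2) show ?case
    by (auto intro: converse_rtranclp_into_rtranclp[of "hop e" x u])
qed simp

lemma walk_hop_change:
  "walk (hop c) x vs y \<Longrightarrow> e \<notin> set vs \<Longrightarrow> (hop e)\<^sup>*\<^sup>* x y"
proof (induction vs arbitrary: x)
  case (Cons u vs)
  then have "hop c x u" "u \<noteq> e" "(hop e)\<^sup>*\<^sup>* u y" by auto
  then have "hop e x u" "(hop e)\<^sup>*\<^sup>* u y" by (auto simp: hop_def)
  then show ?case by (rule converse_rtranclp_into_rtranclp)
qed simp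

text \<open>The vertices being distinct, each leaf on the walk still owns its initial object when
  the center gets there, so every arc is a legal swap. The clause on the other leaves lets a second,
  disjoint walk follow.\<close>

lemma swaps_along_walk:
  assumes "walk (hop e) x vs y" "distinct vs" "\<forall>v\<in>set vs. \<sigma> v = v" "\<sigma> c = x"
  shows "\<exists>\<tau>. (swap_step I)\<^sup>*\<^sup>* \<sigma> \<tau> \<and> \<tau> c = y \<and> (\<forall>j. j \<noteq> c \<longrightarrow> j \<notin> set vs \<longrightarrow> \<tau> j = \<sigma> j)"
  using assms
proof (induction vs arbitrary: x \<sigma>)
  case Nil
  then show ?case by auto
next
  case (Cons v vs)
  define \<sigma>' where "\<sigma>' = \<sigma>(c := \<sigma> v, v := \<sigma> c)"
  have hop: "hop e x v" and w: "walk (hop e) v vs y" using Cons.prems by auto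
  have v: "v < n" "v \<noteq> c" "\<sigma> v = v" using hop Cons.prems by (auto simp: hop_def)
  have step: "swap_step I \<sigma> \<sigma>'"
    unfolding swap_step_iff using hop v Cons.prems(4) by (auto simp: hop_def arc_def \<sigma>'_def)
  have "\<forall>u\<in>set vs. \<sigma>' u = u" "\<sigma>' c = v"
    using Cons.prems v walk_hop_set[OF w] by (auto simp: \<sigma>'_def)
  then obtain \<tau> where "(swap_step I)\<^sup>*\<^sup>* \<sigma>' \<tau>" "\<tau> c = y"
    "\<forall>j. j \<noteq> c \<longrightarrow> j \<notin> set vs \<longrightarrow> \<tau> j = \<sigma>' j"
    using Cons.IH[OF w] Cons.prems(2) by auto
  then show ?case
    using converse_rtranclp_into_rtranclp[of "swap_step I", OF step]
    by (intro exI[of _ \<tau>]) (auto simp: \<sigma>'_def)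
qed

section \<open>Characterisation of reachability by searches in the digraph\<close>

text \<open>In the last case \<open>z\<close> is what \<open>k\<close> receives first and later
  returns for \<open>a\<close>; the two comparisons of \<open>z\<close> and \<open>a\<close> are the
  consents of the center and of \<open>k\<close> to that exchange.\<close>

definition obtainable :: "nat \<Rightarrow> nat \<Rightarrow> bool" where
  "obtainable k a \<longleftrightarrow>
     (if k = c then (hop k)\<^sup>*\<^sup>* c a
      else a = k \<or> ((hop k)\<^sup>*\<^sup>* c a \<and> arc a k) \<or>
        ((hop c)\<^sup>*\<^sup>* k a \<and>
          (\<exists>z. (hop k)\<^sup>*\<^sup>* c z \<and> arc z k \<and> (z, a) \<in> pref I c \<and> (a, z) \<in> pref I k)))"

text \<open>The clause on the leaves carries the induction: a leaf may hand back an object other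
  than its own, and that object must be known to have passed through the center.\<close>

lemma reachable_center_imp:
  assumes "(swap_step I)\<^sup>*\<^sup>* initial_assignment \<sigma>"
  shows "(hop c)\<^sup>*\<^sup>* c (\<sigma> c) \<and> (\<forall>j<n. \<sigma> j = j \<or> (hop c)\<^sup>*\<^sup>* c (\<sigma> j))"
  using assms
proof (induction rule: rtranclp_induct)
  case base
  then show ?case by (simp add: initial_assignment_def)
next
  case (step \<sigma> \<tau>)
  then obtain j where j: "j < n" "j \<noteq> c" "(\<sigma> c, \<sigma> j) \<in> pref I j" "(\<sigma> j, \<sigma> c) \<in> pref I c"
    "\<tau> = \<sigma>(c := \<sigma> j, j := \<sigma> c)" by (auto simp: swap_step_iff)
  have "(hop c)\<^sup>*\<^sup>* c (\<sigma> j)"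
  proof (cases "\<sigma> j = j")
    case True
    then have "hop c (\<sigma> c) (\<sigma> j)" using j by (simp add: hop_def arc_def)
    then show ?thesis using step.IH by (meson rtranclp.rtrancl_into_rtrancl)
  qed (use step.IH j in blast)
  then show ?case using step.IH j by auto
qed

text \<open>The invariant distinguishes whether leaf \<open>k\<close> has taken part in a swap. If so, \<open>z\<close> is the
  object it received in its first swap; from then on every object passing through \<open>k\<close> is as
  good as \<open>z\<close> for \<open>k\<close> and no better than \<open>z\<close> for the center.\<close>

lemma reachable_leaf_imp:
  fixes k :: nat
  assumes "(swap_step I)\<^sup>*\<^sup>* initial_assignment \<sigma>" and k: "k < n" "k \<noteq> c"
  defines "R \<equiv> \<lambda>x. (hop k)\<^sup>*\<^sup>* c x" and "S \<equiv> \<lambda>x. (hop k)\<^sup>*\<^sup>* c x \<or> (hop c)\<^sup>*\<^sup>* k x"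
  shows "(\<sigma> k = k \<and> R (\<sigma> c) \<and> (\<forall>j<n. \<sigma> j = j \<or> R (\<sigma> j))) \<or>
    (S (\<sigma> c) \<and> S (\<sigma> k) \<and> (\<forall>j<n. \<sigma> j = j \<or> S (\<sigma> j)) \<and>
      (\<exists>z. R z \<and> arc z k \<and> (z, \<sigma> k) \<in> pref I c \<and> (\<sigma> k, z) \<in> pref I k))"
    (is "?fresh \<sigma> \<or> ?used \<sigma>")
  using assms(1)
proof (induction rule: rtranclp_induct)
  case base
  then show ?case by (simp add: initial_assignment_def R_def)
next
  case (step \<sigma> \<tau>)
  then obtain j where j: "j < n" "j \<noteq> c" "(\<sigma> c, \<sigma> j) \<in> pref I j" "(\<sigma> j, \<sigma> c) \<in> pref I c"
    and \<tau>: "\<tau> = \<sigma>(c := \<sigma> j, j := \<sigma> c)" by (auto simp: swap_step_iff)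
  have RS: "R x \<Longrightarrow> S x" for x by (simp add: R_def S_def)
  have arc: "arc (\<sigma> c) j" if "\<sigma> j = j" using that j by (simp add: arc_def)
  have R_step: "R j" if "R (\<sigma> c)" "\<sigma> j = j" "j \<noteq> k"
    using that j arc unfolding R_def
    by (meson hop_def rtranclp.rtrancl_into_rtrancl)
  have S_step: "S j" if "S (\<sigma> c)" "\<sigma> j = j" "j \<noteq> k"
    using that j arc unfolding S_def
    by (meson hop_def rtranclp.rtrancl_into_rtrancl)
  from step.IH show ?case
  proof
    assume fresh: "?fresh \<sigma>"
    show ?case
    proof (cases "j = k")
      case True
      have "S k" by (simp add: S_def)
      \<comment> \<open>This is the first swap of \<open>k\<close>: the received object
        \<open>\<sigma> c\<close> becomes \<open>z\<close>, and reflexivity, which needs this bound,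
        gives both comparisons.\<close>
      have "\<sigma> c < n" using fresh hop_less center unfolding R_def by blast
      then have "arc (\<sigma> c) k" "(\<sigma> c, \<sigma> c) \<in> pref I c" "(\<sigma> c, \<sigma> c) \<in> pref I k"
        using arc fresh True pref_refl center k by auto
      then have "?used \<tau>" using fresh True \<tau> \<open>S k\<close> RS j k by auto
      then show ?thesis ..
    next
      case False
      then have "R (\<sigma> j)" using R_step fresh j(1) by metis
      then have "?fresh \<tau>" using fresh False \<tau> k by auto
      then show ?thesis ..
    qed
  next
    assume used: "?used \<sigma>"
    show ?case
    proof (cases "j = k")
      case True
      from used obtain z where z: "R z" "arc z k" "(z, \<sigma> k) \<in> pref I c" "(\<sigma> k, z) \<in> pref I k"
        by blast
      \<comment> \<open>The consents of the center and of \<open>k\<close> to the present swap are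
        chained with the old comparisons; \<open>z\<close> stays fixed.\<close>
      then have "(z, \<sigma> c) \<in> pref I c" "(\<sigma> c, z) \<in> pref I k"
        using j True pref_trans center k by blast+
      then have "?used \<tau>" using used True \<tau> z j by auto
      then show ?thesis ..
    next
      case False
      then have "S (\<sigma> j)" using S_step used j(1) by metis
      then have "?used \<tau>" using used False \<tau> k by auto
      then show ?thesis ..
    qed
  qed
qed

lemma obtainable_if_reachable:
  assumes "reachable I k a" "k < n"
  shows "obtainable k a"
proof -
  from assms obtain \<sigma> where \<sigma>: "(swap_step I)\<^sup>*\<^sup>* initial_assignment \<sigma>" "\<sigma> k = a"
    unfolding reachable_def by blast
  show ?thesis
  proof (cases "k = c")
    case True
    then show ?thesis using reachable_center_imp[OF \<sigma>(1)] \<sigma>(2) by (simp add: obtainable_def)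
  next
    case False
    from reachable_leaf_imp[OF \<sigma>(1) assms(2) False]
    consider "a = k" | z where "(hop k)\<^sup>*\<^sup>* c z" "arc z k" "(z, a) \<in> pref I c" "(a, z) \<in> pref I k"
      "(hop k)\<^sup>*\<^sup>* c a \<or> (hop c)\<^sup>*\<^sup>* k a"
      using \<sigma>(2) by blast
    then show ?thesis
    proof cases
      case 1
      then show ?thesis using False by (simp add: obtainable_def)
    next
      case 2
      \<comment> \<open>Both agents like \<open>a\<close> at \<open>k\<close> at least as well as
        \<open>z\<close> is liked in \<open>arc z k\<close>, so if \<open>a\<close> is reachable
        without \<open>k\<close>, the direct case applies.\<close>
      then have "arc a k"
        using pref_trans center assms(2) unfolding arc_def by blast
      then show ?thesis using 2 False unfolding obtainable_def by auto
    qed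
  qed
qed

lemma reachable_by_leaf_swap:
  assumes "(swap_step I)\<^sup>*\<^sup>* initial_assignment \<sigma>" "\<sigma> c = a" "k < n" "k \<noteq> c"
    "(a, \<sigma> k) \<in> pref I k" "(\<sigma> k, a) \<in> pref I c"
  shows "reachable I k a"
proof -
  let ?\<tau> = "\<sigma>(c := \<sigma> k, k := \<sigma> c)"
  have "swap_step I \<sigma> ?\<tau>" using assms unfolding swap_step_iff by blast
  then have "(swap_step I)\<^sup>*\<^sup>* initial_assignment ?\<tau>"
    using assms(1) by (rule rtranclp.rtrancl_into_rtrancl[rotated])
  then show ?thesis unfolding reachable_def using assms(2) by (intro exI[of _ ?\<tau>]) simp
qed

lemma reachable_if_obtainable:
  assumes "obtainable k a" "k < n"
  shows "reachable I k a"
proof -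
  \<comment> \<open>Leaves outside the set reachable without \<open>k\<close> are left untouched,
    which later makes room for the walk that starts at \<open>k\<close>.\<close>
  have from_center: "\<exists>\<sigma>. (swap_step I)\<^sup>*\<^sup>* initial_assignment \<sigma> \<and> \<sigma> c = b \<and>
      (\<forall>j. j \<noteq> c \<longrightarrow> \<not> (hop k)\<^sup>*\<^sup>* c j \<longrightarrow> \<sigma> j = j)" if cb: "(hop k)\<^sup>*\<^sup>* c b" for b
  proof -
    obtain vs where vs: "walk (hop k) c vs b" "distinct (c # vs)"
      using rtranclp_imp_distinct_walk[OF cb] by blast
    then obtain \<sigma> where "(swap_step I)\<^sup>*\<^sup>* initial_assignment \<sigma>" "\<sigma> c = b"
      "\<forall>j. j \<noteq> c \<longrightarrow> j \<notin> set vs \<longrightarrow> \<sigma> j = initial_assignment j"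
      using swaps_along_walk[OF vs(1), of initial_assignment] by (auto simp: initial_assignment_def)
    moreover have "\<forall>j. \<not> (hop k)\<^sup>*\<^sup>* c j \<longrightarrow> j \<notin> set vs" using walk_hop_set[OF vs(1)] by blast
    ultimately show ?thesis by (auto simp: initial_assignment_def)
  qed
  show ?thesis
  proof (cases "k = c")
    case True
    then have "(hop k)\<^sup>*\<^sup>* c a" using assms(1) by (simp add: obtainable_def)
    from from_center[OF this] show ?thesis using True unfolding reachable_def by blast
  next
    case False
    have kR: "\<not> (hop k)\<^sup>*\<^sup>* c k" using hop_avoids False by blast
    have direct: "reachable I k a" if ca: "(hop k)\<^sup>*\<^sup>* c a" "arc a k"
    proof -
      obtain \<sigma> where \<sigma>: "(swap_step I)\<^sup>*\<^sup>* initial_assignment \<sigma>" "\<sigma> c = a" "\<sigma> k = k"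
        using from_center[OF ca(1)] kR False by blast
      show ?thesis
        by (rule reachable_by_leaf_swap[OF \<sigma>(1,2) assms(2) False]) (use \<sigma> ca in \<open>auto simp: arc_def\<close>)
    qed
    \<comment> \<open>The third case may assume that \<open>a\<close> is not reachable without
      \<open>k\<close>: otherwise transitivity turns \<open>arc z k\<close> into
      \<open>arc a k\<close>, and the direct swap applies.\<close>
    consider "a = k" | "(hop k)\<^sup>*\<^sup>* c a" "arc a k"
      | z where "\<not> (hop k)\<^sup>*\<^sup>* c a" "(hop c)\<^sup>*\<^sup>* k a" "(hop k)\<^sup>*\<^sup>* c z" "arc z k"
        "(z, a) \<in> pref I c" "(a, z) \<in> pref I k"
    proof -
      have "arc a k" if "arc z k" "(z, a) \<in> pref I c" "(a, z) \<in> pref I k" for z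
        using that pref_trans center assms(2) unfolding arc_def by blast
      then show ?thesis using that assms(1) False unfolding obtainable_def by (simp only: if_False) blast
    qed
    then show ?thesis
    proof cases
      case 1
      have "(swap_step I)\<^sup>*\<^sup>* initial_assignment initial_assignment" by simp
      then show ?thesis using 1 unfolding reachable_def initial_assignment_def by blast
    next
      case 2
      then show ?thesis by (rule direct)
    next
      case 3
      obtain \<sigma> where \<sigma>: "(swap_step I)\<^sup>*\<^sup>* initial_assignment \<sigma>" "\<sigma> c = z"
          "\<forall>j. j \<noteq> c \<longrightarrow> \<not> (hop k)\<^sup>*\<^sup>* c j \<longrightarrow> \<sigma> j = j"
        using from_center[OF 3(3)] by blast
      define \<sigma>' where "\<sigma>' = \<sigma>(c := \<sigma> k, k := \<sigma> c)"
      have "\<sigma> k = k" using \<sigma> kR False by blast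
      then have "swap_step I \<sigma> \<sigma>'"
        using 3 \<sigma>(2) assms(2) False unfolding swap_step_iff \<sigma>'_def arc_def by metis
      then have \<sigma>'_reach: "(swap_step I)\<^sup>*\<^sup>* initial_assignment \<sigma>'"
        using \<sigma>(1) by (rule rtranclp.rtrancl_into_rtrancl[rotated])
      obtain vs where vs: "walk (hop c) k vs a" "distinct (k # vs)"
        using rtranclp_imp_distinct_walk[OF 3(2)] by blast
      \<comment> \<open>Beyond such a \<open>v\<close> the simple walk no longer meets
        \<open>k\<close>, so \<open>a\<close> would be reachable without \<open>k\<close>, against
        the case assumption.\<close>
      have fresh: "\<not> (hop k)\<^sup>*\<^sup>* c v" if v: "v \<in> set vs" for v
      proof
        assume cv: "(hop k)\<^sup>*\<^sup>* c v"
        obtain us ws where "vs = us @ v # ws" using v by (meson split_list)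
        then have "walk (hop c) v ws a" "k \<notin> set ws"
          using vs walk_Cons_split(2)[of "hop c" k us v ws a] by auto
        then have "(hop k)\<^sup>*\<^sup>* v a" by (rule walk_hop_change)
        with cv 3(1) show False by (meson rtranclp_trans)
      qed
      have "\<forall>v\<in>set vs. \<sigma>' v = v"
        using vs fresh \<sigma>(3) walk_hop_set[OF vs(1)] by (auto simp: \<sigma>'_def)
      then obtain \<tau> where "(swap_step I)\<^sup>*\<^sup>* \<sigma>' \<tau>" "\<tau> c = a" "\<tau> k = \<sigma>' k"
        using swaps_along_walk[OF vs(1), of \<sigma>'] vs(2) \<open>\<sigma> k = k\<close> False
        by (auto simp: \<sigma>'_def)
      moreover have "\<sigma>' k = z" using \<sigma>(2) by (simp add: \<sigma>'_def)
      ultimately show ?thesis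
        using reachable_by_leaf_swap[of \<tau> a k] \<sigma>'_reach 3(5,6) assms(2) False
        by (auto dest: rtranclp_trans)
    qed
  qed
qed

lemma reachable_iff_obtainable: "k < n \<Longrightarrow> reachable I k a \<longleftrightarrow> obtainable k a"
  using obtainable_if_reachable reachable_if_obtainable by blast

end

section \<open>Reasoning about running time\<close>

fun loop_free :: "prog \<Rightarrow> bool" where
  "loop_free (Seq P Q) \<longleftrightarrow> loop_free P \<and> loop_free Q"
| "loop_free (Cond b P Q) \<longleftrightarrow> loop_free P \<and> loop_free Q"
| "loop_free (Loop b P) \<longleftrightarrow> False"
| "loop_free P \<longleftrightarrow> True"

text \<open>The values of \<open>cost\<close> and \<open>effect\<close> for loops are junk.\<close>

fun cost :: "prog \<Rightarrow> nat" where
  "cost Skip = 1"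
| "cost (Assign x a) = 1 + acost a"
| "cost (Write a b) = 1 + acost a + acost b"
| "cost (Seq P Q) = cost P + cost Q"
| "cost (Cond b P Q) = 1 + bcost b + max (cost P) (cost Q)"
| "cost (Loop b P) = 0"

fun effect :: "nat \<Rightarrow> prog \<Rightarrow> state \<Rightarrow> state" where
  "effect w Skip s = s"
| "effect w (Assign x a) s = s\<lparr>regs := (regs s)(x := aval w a s)\<rparr>"
| "effect w (Write a b) s = s\<lparr>mem := (mem s)(aval w a s := aval w b s)\<rparr>"
| "effect w (Seq P Q) s = effect w Q (effect w P s)"
| "effect w (Cond b P Q) s = (if bval w b s then effect w P s else effect w Q s)"
| "effect w (Loop b P) s = s"

lemma exec_loop_free: "loop_free P \<Longrightarrow> \<exists>t\<le>cost P. exec w P s t (effect w P s)"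
proof (induction P arbitrary: s)
  case (Seq P Q)
  then obtain t u where "t \<le> cost P" "exec w P s t (effect w P s)"
    "u \<le> cost Q" "exec w Q (effect w P s) u (effect w Q (effect w P s))"
    by (meson loop_free.simps(1))
  then show ?case using exec.Seq by (intro exI[of _ "t + u"]) auto
next
  case (Cond b P Q)
  then obtain t u where t: "t \<le> cost P" "exec w P s t (effect w P s)"
    and u: "u \<le> cost Q" "exec w Q s u (effect w Q s)"
    by (meson loop_free.simps(2))
  show ?case
  proof (cases "bval w b s")
    case True
    then show ?thesis
      using t exec.CondTrue[OF True t(2), of Q] by (intro exI[of _ "1 + bcost b + t"]) auto
  next
    case False
    then show ?thesis
      using u exec.CondFalse[OF False u(2), of P] by (intro exI[of _ "1 + bcost b + u"]) auto
  qed
qed (auto intro: exec.intros exec.Skip[simplified] exec.Assign[simplified] exec.Write[simplified])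

section \<open>Total correctness with a time budget\<close>

text \<open>The starting state is an argument rather than a precondition, so the postcondition can
  refer to it.\<close>

definition halts :: "nat \<Rightarrow> prog \<Rightarrow> nat \<Rightarrow> (state \<Rightarrow> bool) \<Rightarrow> state \<Rightarrow> bool" where
  "halts w P B Q s \<longleftrightarrow> (\<exists>t s'. exec w P s t s' \<and> t \<le> B \<and> Q s')"

lemma halts_loop_free: "loop_free P \<Longrightarrow> cost P \<le> B \<Longrightarrow> Q (effect w P s) \<Longrightarrow> halts w P B Q s"
  unfolding halts_def using exec_loop_free[of P w s] by (meson le_trans)

lemma halts_Seq:
  assumes "halts w P B Q s" "\<And>s'. Q s' \<Longrightarrow> halts w P' B' R s'"
  shows "halts w (Seq P P') (B + B') R s"
proof -
  from assms(1) obtain t s' where 1: "exec w P s t s'" "t \<le> B" "Q s'" unfolding halts_def by blast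
  with assms(2) obtain t' s'' where "exec w P' s' t' s''" "t' \<le> B'" "R s''"
    unfolding halts_def by blast
  with 1 show ?thesis unfolding halts_def by (meson add_mono exec.Seq)
qed

lemma halts_mono:
  "halts w P B Q s \<Longrightarrow> B \<le> B' \<Longrightarrow> (\<And>s'. Q s' \<Longrightarrow> Q' s') \<Longrightarrow> halts w P B' Q' s"
  unfolding halts_def by (meson le_trans)

text \<open>Each iteration lowers \<open>\<mu>\<close> by at least one and pays for one test and the
  body; the last summand pays for the final failing test.\<close>

lemma halts_Loop:
  fixes \<mu> :: "state \<Rightarrow> nat"
  assumes "Inv s"
    and step: "\<And>s. Inv s \<Longrightarrow> bval w b s \<Longrightarrow> halts w P B (\<lambda>s'. Inv s' \<and> \<mu> s' < \<mu> s) s"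
  shows "halts w (Loop b P) (\<mu> s * (1 + bcost b + B) + (1 + bcost b))
           (\<lambda>s'. Inv s' \<and> \<not> bval w b s') s"
  using assms(1)
proof (induction "\<mu> s" arbitrary: s rule: less_induct)
  case less
  let ?K = "1 + bcost b + B"
  show ?case
  proof (cases "bval w b s")
    case False
    then show ?thesis unfolding halts_def using less.prems exec.LoopFalse[OF False, of P]
      by (intro exI[of _ "1 + bcost b"] exI[of _ s]) auto
  next
    case True
    from step[OF less.prems True] obtain t s' where 1: "exec w P s t s'" "t \<le> B" "Inv s'"
      "\<mu> s' < \<mu> s" unfolding halts_def by blast
    from less.hyps[OF 1(4,3)] obtain t' s'' where 2: "exec w (Loop b P) s' t' s''"
      "t' \<le> \<mu> s' * ?K + (1 + bcost b)" "Inv s''" "\<not> bval w b s''" unfolding halts_def by blast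
    have "Suc (\<mu> s') * ?K \<le> \<mu> s * ?K" using 1(4) by (intro mult_right_mono) auto
    then have "1 + bcost b + t + t' \<le> \<mu> s * ?K + (1 + bcost b)"
      using 1(2) 2(2) by simp
    then show ?thesis unfolding halts_def using exec.LoopTrue[OF True 1(1) 2(1)] 2(3,4) by blast
  qed
qed

section \<open>The program\<close>

text \<open>The loop finds the last neighbour of agent 0, which is the center unless agent 0 is; in that
  case and with at least three agents, agents 1 and 2 are both neighbours of agent 0. With two
  agents, either of them may serve as the center.\<close>

definition find_center :: prog where
  "find_center =
     Seq (Seq (Assign ''c'' (Const 0)) (Assign ''i'' (Const 0)))
    (Seq (Loop (Less (Reg ''i'') (Reg ''n''))
       (Seq (Cond (Equal (Read (Reg ''i'')) (Const 1)) (Assign ''c'' (Reg ''i'')) Skip)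
            (Assign ''i'' (Plus (Reg ''i'') (Const 1)))))
     (Cond (Conj (Less (Const 2) (Reg ''n''))
             (Conj (Equal (Read (Const 1)) (Const 1)) (Equal (Read (Const 2)) (Const 1))))
        (Assign ''c'' (Const 0)) Skip))"

definition square_n :: aexp where
  "square_n = Times (Reg ''n'') (Reg ''n'')"

definition rank_at :: "aexp \<Rightarrow> aexp \<Rightarrow> aexp" where
  "rank_at i x = Read (Plus square_n (Plus (Times i (Reg ''n'')) x))"

definition pref_test :: "aexp \<Rightarrow> aexp \<Rightarrow> aexp \<Rightarrow> bexp" where
  "pref_test i x y = Neg (Less (rank_at i y) (rank_at i x))"

definition arc_test :: "aexp \<Rightarrow> aexp \<Rightarrow> bexp" where
  "arc_test x j = Conj (pref_test j x j) (pref_test (Reg ''c'') j x)"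

text \<open>Breadth-first search: the cells \<open>base, \<dots>, base + n - 1\<close> hold the marks and the next
  \<open>n\<close> cells the queue, whose entries from \<open>h\<close> to \<open>t - 1\<close> are still to be expanded.\<close>

definition visit_test :: bexp where
  "visit_test =
     Conj (Neg (Equal (Reg ''j'') (Reg ''c'')))
    (Conj (Neg (Equal (Reg ''j'') (Reg ''ex'')))
    (Conj (Equal (Read (Plus (Reg ''base'') (Reg ''j''))) (Const 0))
       (arc_test (Reg ''u'') (Reg ''j''))))"

definition visit :: prog where
  "visit =
     Seq (Write (Plus (Reg ''base'') (Reg ''j'')) (Const 1))
    (Seq (Write (Plus (Plus (Reg ''base'') (Reg ''n'')) (Reg ''t'')) (Reg ''j''))
     (Assign ''t'' (Plus (Reg ''t'') (Const 1))))"

definition expand :: prog where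
  "expand =
     Seq (Seq (Assign ''u'' (Read (Plus (Plus (Reg ''base'') (Reg ''n'')) (Reg ''h''))))
              (Assign ''j'' (Const 0)))
    (Seq (Loop (Less (Reg ''j'') (Reg ''n''))
       (Seq (Cond visit_test visit Skip) (Assign ''j'' (Plus (Reg ''j'') (Const 1)))))
     (Assign ''h'' (Plus (Reg ''h'') (Const 1))))"

definition search :: prog where
  "search =
     Seq (Seq (Assign ''h'' (Const 0))
         (Seq (Assign ''t'' (Const 1))
         (Seq (Write (Plus (Reg ''base'') (Reg ''src'')) (Const 1))
              (Write (Plus (Reg ''base'') (Reg ''n'')) (Reg ''src'')))))
     (Loop (Less (Reg ''h'') (Reg ''t'')) expand)"

text \<open>\<open>mark\<close> and \<open>base\<close> point to the marks of the first and of the second search.\<close>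

definition witness_test :: bexp where
  "witness_test =
     Conj (Equal (Read (Plus (Reg ''mark'') (Reg ''i''))) (Const 1))
    (Conj (arc_test (Reg ''i'') (Reg ''agent''))
    (Conj (pref_test (Reg ''c'') (Reg ''i'') (Reg ''object''))
       (pref_test (Reg ''agent'') (Reg ''object'') (Reg ''i''))))"

definition find_witness :: prog where
  "find_witness =
     Seq (Seq (Assign ''i'' (Const 0)) (Assign ''found'' (Const 0)))
     (Loop (Less (Reg ''i'') (Reg ''n''))
       (Seq (Cond witness_test (Assign ''found'' (Const 1)) Skip)
            (Assign ''i'' (Plus (Reg ''i'') (Const 1)))))"

definition conclude :: prog where
  "conclude =
     Cond (Equal (Reg ''agent'') (Reg ''c''))
       (Assign ''answer'' (Read (Plus (Reg ''mark'') (Reg ''object''))))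
    (Cond (Equal (Reg ''object'') (Reg ''agent'')) (Assign ''answer'' (Const 1))
    (Cond (Conj (Equal (Read (Plus (Reg ''mark'') (Reg ''object''))) (Const 1))
             (arc_test (Reg ''object'') (Reg ''agent''))) (Assign ''answer'' (Const 1))
    (Cond (Conj (Equal (Read (Plus (Reg ''base'') (Reg ''object''))) (Const 1))
             (Equal (Reg ''found'') (Const 1))) (Assign ''answer'' (Const 1))
       (Assign ''answer'' (Const 0)))))"

text \<open>The work space starts at \<open>2 * n * n\<close>, right behind adjacency matrix and
  rank table.\<close>

definition first_input :: prog where
  "first_input =
     Seq (Assign ''base'' (Plus square_n square_n))
    (Seq (Assign ''mark'' (Reg ''base''))
    (Seq (Assign ''src'' (Reg ''c'')) (Assign ''ex'' (Reg ''agent''))))"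

text \<open>The offset skips the marks and the queue of the first search, whose marks are still read
  afterwards.\<close>

definition second_input :: prog where
  "second_input =
     Seq (Assign ''base'' (Plus (Reg ''mark'') (Plus (Reg ''n'') (Reg ''n''))))
    (Seq (Assign ''src'' (Reg ''agent'')) (Assign ''ex'' (Reg ''c'')))"

definition reach_prog :: prog where
  "reach_prog =
     Seq find_center (Seq first_input (Seq search (Seq second_input (Seq search
       (Seq find_witness conclude)))))"

section \<open>Word length and evaluation of the tests\<close>

text \<open>The input takes \<open>2 * n * n\<close> cells and each of the two searches
  \<open>2 * n\<close>, so all addresses are covered. The inequality follows from
  \<open>4 \<le> (n + 1) ^ 2\<close>, one of the two squares in the fourth power.\<close>

lemma square_bound:
  fixes n w :: nat
  assumes "(n + 1) ^ 4 \<le> 2 ^ w" "0 < n" "m \<le> 2 * n * n + 4 * n"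
  shows "m < 2 ^ w"
proof -
  have "4 \<le> (n + 1) ^ 2" using assms(2) power_mono[of 2 "n + 1" 2] by simp
  then have "4 * (n + 1) ^ 2 \<le> (n + 1) ^ 2 * (n + 1) ^ 2" by (rule mult_right_mono) simp
  also have "\<dots> = (n + 1) ^ 4" by (simp flip: power_add)
  finally have "4 * (n + 1) ^ 2 \<le> 2 ^ w" using assms(1) by simp
  moreover have "m < 4 * (n + 1) ^ 2" using assms(3) by (simp add: power2_eq_square algebra_simps)
  ultimately show ?thesis by simp
qed

lemma row_index_less:
  fixes i x n :: nat
  assumes "i < n" "x < n"
  shows "i * n + x < n * n"
proof -
  have "Suc i * n \<le> n * n" using assms(1) by (intro mult_right_mono) auto
  then show ?thesis using assms(2) by simp
qed

locale star_ram = star_market +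
  fixes w :: nat
  assumes word: "(size_of I + 1) ^ 4 \<le> 2 ^ w"
begin

lemma word_less: "m \<le> 2 * n * n + 4 * n \<Longrightarrow> m < 2 ^ w"
  using square_bound[OF word] center by auto

lemma word_pos [simp]: "0 < w" and two_mod_word [simp]: "2 mod 2 ^ w = (2::nat)"
proof -
  have "2 \<le> 4 * n" using center by linarith
  then have "2 < (2::nat) ^ w" by (intro word_less) linarith
  then show "0 < w" "2 mod 2 ^ w = (2::nat)" by (auto intro: gr0I)
qed

text \<open>Only the input region is constrained, so writing to the work space preserves it.\<close>

definition loaded :: "state \<Rightarrow> bool" where
  "loaded s \<longleftrightarrow> regs s ''n'' = n \<and> regs s ''c'' = c \<and> (\<forall>p<2 * n * n. mem s p = input_mem I p)"

lemma aval_square_n: "regs s ''n'' = n \<Longrightarrow> aval w square_n s = n * n"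
  using word_less[of "n * n"] by (simp add: square_n_def)

lemma aval_rank_at:
  assumes "loaded s" "aval w i s < n" "aval w x s < n"
  shows "aval w (rank_at i x) s = rank I (aval w i s) (aval w x s)"
proof -
  let ?i = "aval w i s" and ?x = "aval w x s"
  have lt: "?i * n + ?x < n * n" using assms(2,3) by (rule row_index_less)
  then have "?i * n < 2 ^ w" "?i * n + ?x < 2 ^ w" "n * n + (?i * n + ?x) < 2 ^ w"
    by (auto intro!: word_less)
  then have "aval w (rank_at i x) s = mem s (n * n + (?i * n + ?x))"
    using assms(1) by (simp add: rank_at_def aval_square_n loaded_def)
  also have "\<dots> = input_mem I (n * n + (?i * n + ?x))" using assms(1) lt by (simp add: loaded_def)
  also have "\<dots> = rank I ?i ?x"
    using lt assms(2,3) by (simp add: input_mem_def Let_def)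
  finally show ?thesis .
qed

lemma bval_pref_test:
  assumes "loaded s" "aval w i s < n" "aval w x s < n" "aval w y s < n"
  shows "bval w (pref_test i x y) s \<longleftrightarrow> (aval w x s, aval w y s) \<in> pref I (aval w i s)"
  using assms by (simp add: pref_test_def aval_rank_at not_less rank_le_iff)

lemma bval_arc_test:
  assumes "loaded s" "aval w x s < n" "aval w j s < n"
  shows "bval w (arc_test x j) s \<longleftrightarrow> arc (aval w x s) (aval w j s)"
  using assms center by (simp add: arc_test_def bval_pref_test arc_def loaded_def)

subsection \<open>Breadth-first search\<close>

definition frame :: "nat \<Rightarrow> state \<Rightarrow> state \<Rightarrow> bool" where
  "frame B s0 s \<longleftrightarrow>
     (\<forall>x. x \<notin> {''h'', ''t'', ''j'', ''u''} \<longrightarrow> regs s x = regs s0 x) \<and>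
     (\<forall>p. p < B \<or> B + 2 * n \<le> p \<longrightarrow> mem s p = mem s0 p)"

text \<open>Nothing is ever removed from \<open>qs\<close>: expanded entries stay in front of
  position \<open>h\<close>, so the set of \<open>qs\<close> is the set of marked vertices.\<close>

definition queue :: "nat \<Rightarrow> nat list \<Rightarrow> state \<Rightarrow> bool" where
  "queue B qs s \<longleftrightarrow> regs s ''t'' = length qs \<and> distinct qs \<and> set qs \<subseteq> {..<n} \<and>
     (\<forall>i<length qs. mem s (B + n + i) = qs ! i) \<and>
     (\<forall>j<n. mem s (B + j) = (if j \<in> set qs then 1 else 0))"

text \<open>Counting distinct vertices below \<open>n\<close>. The first bound limits the number of
  expansions; the strict one keeps a new entry inside the \<open>n\<close> queue cells.\<close>

lemma queue_length:
  assumes "queue B qs s"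
  shows "length qs \<le> n" "j < n \<Longrightarrow> j \<notin> set qs \<Longrightarrow> length qs < n"
proof -
  have q: "distinct qs" "set qs \<subseteq> {..<n}" using assms by (auto simp: queue_def)
  then show "length qs \<le> n" using distinct_card[of qs] card_mono[of "{..<n}" "set qs"] by simp
  assume "j < n" "j \<notin> set qs"
  then have "set qs \<subset> {..<n}" using q by auto
  then show "length qs < n" using distinct_card[OF q(1)] psubset_card_mono[of "{..<n}" "set qs"] by simp
qed

lemma frame_loaded: "frame B s0 s \<Longrightarrow> 2 * n * n \<le> B \<Longrightarrow> loaded s0 \<Longrightarrow> loaded s"
  by (simp add: frame_def loaded_def)

lemma visit_queue:
  assumes "queue B qs s" "frame B s0 s" "regs s0 ''base'' = B" "regs s0 ''n'' = n"
    "B + 2 * n \<le> 2 * n * n + 4 * n" "regs s ''j'' = j" "j < n" "j \<notin> set qs"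
  shows "queue B (qs @ [j]) (effect w visit s)" "frame B s0 (effect w visit s)"
    "x \<noteq> ''t'' \<Longrightarrow> regs (effect w visit s) x = regs s x"
proof -
  have len: "length qs < n" using queue_length(2)[OF assms(1,7,8)] .
  have regs: "regs s ''base'' = B" "regs s ''n'' = n" "regs s ''t'' = length qs"
    using assms by (auto simp: frame_def queue_def)
  have "B + j < 2 ^ w" "B + n < 2 ^ w" "B + n + length qs < 2 ^ w" "Suc (length qs) < 2 ^ w"
    using len assms(5,7) by (auto intro!: word_less)
  then have eff: "effect w visit s = s\<lparr>mem := (mem s)(B + j := 1, B + n + length qs := j),
      regs := (regs s)(''t'' := Suc (length qs))\<rparr>"
    using regs assms(6) by (simp add: visit_def)
  show "queue B (qs @ [j]) (effect w visit s)"
    using assms(1,7,8) len unfolding eff queue_def by (auto simp: nth_append)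
  show "frame B s0 (effect w visit s)"
    using assms(2,7) len unfolding eff frame_def by auto
  show "x \<noteq> ''t'' \<Longrightarrow> regs (effect w visit s) x = regs s x" unfolding eff by simp
qed

text \<open>During the expansion of entry \<open>h\<close>, all arcs from earlier entries, and from this one to
  vertices below \<open>m\<close>, have been followed.\<close>

definition expanding :: "nat \<Rightarrow> nat \<Rightarrow> nat \<Rightarrow> state \<Rightarrow> nat list \<Rightarrow> nat \<Rightarrow> nat \<Rightarrow> state \<Rightarrow> bool" where
  "expanding B e v s0 qs h m s \<longleftrightarrow>
     queue B qs s \<and> frame B s0 s \<and> regs s ''h'' = h \<and> v \<in> set qs \<and> h \<le> length qs \<and>
     (\<forall>y\<in>set qs. (hop e)\<^sup>*\<^sup>* v y) \<and>
     (\<forall>i<h. \<forall>y. hop e (qs ! i) y \<longrightarrow> y \<in> set qs) \<and>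
     (\<forall>y<m. hop e (qs ! h) y \<longrightarrow> y \<in> set qs)"

context
  fixes s0 :: state and B e v :: nat
  assumes loaded0: "loaded s0" and B: "2 * n * n \<le> B" "B + 2 * n \<le> 2 * n * n + 4 * n"
    and regs0: "regs s0 ''base'' = B" "regs s0 ''ex'' = e" "regs s0 ''src'' = v" and v: "v < n"
begin

lemma expanding_regs:
  assumes "expanding B e v s0 qs h m s"
  shows "regs s ''base'' = B" "regs s ''ex'' = e" "regs s ''n'' = n" "regs s ''c'' = c"
    "regs s ''t'' = length qs" "regs s ''h'' = h" "loaded s"
  using assms loaded0 regs0 frame_loaded[OF _ B(1), of s0 s]
  by (auto simp: expanding_def frame_def queue_def loaded_def)

text \<open>New vertices are appended at the end, so entry \<open>h\<close> and its copy in
  \<open>u\<close> stay valid while the queue grows.\<close>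

lemma expand_inner_step:
  assumes E: "expanding B e v s0 qs h m s" and h: "h < length qs"
    and j: "regs s ''j'' = m" "regs s ''u'' = qs ! h" "m < n"
  defines "s' \<equiv> effect w (Seq (Cond visit_test visit Skip) (Assign ''j'' (Plus (Reg ''j'') (Const 1)))) s"
  shows "\<exists>qs'. expanding B e v s0 qs' h (Suc m) s' \<and> h < length qs' \<and> regs s' ''u'' = qs' ! h"
    "regs s' ''j'' = Suc m"
proof -
  note regs = expanding_regs[OF E]
  have q: "queue B qs s" "frame B s0 s" using E by (auto simp: expanding_def)
  have un: "qs ! h < n" using q(1) nth_mem[OF h] by (auto simp: queue_def)
  have "B + m < 2 ^ w" "Suc m < 2 ^ w" using B j by (auto intro!: word_less)
  then have test: "bval w visit_test s \<longleftrightarrow> hop e (qs ! h) m \<and> m \<notin> set qs"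
    using regs j un q(1) by (auto simp: visit_test_def bval_arc_test hop_def queue_def)
  define s1 where "s1 = effect w (Cond visit_test visit Skip) s"
  have s': "s' = s1\<lparr>regs := (regs s1)(''j'' := (regs s1 ''j'' + 1) mod 2 ^ w)\<rparr>"
    by (simp add: s'_def s1_def)
  have next_if: "expanding B e v s0 qs' h (Suc m) s'"
    if "expanding B e v s0 qs' h (Suc m) s1" for qs'
    using that unfolding s' expanding_def queue_def frame_def by simp
  have "(\<exists>qs'. expanding B e v s0 qs' h (Suc m) s1 \<and> h < length qs' \<and> regs s1 ''u'' = qs' ! h) \<and>
    regs s1 ''j'' = m"
  proof (cases "bval w visit_test s")
    case True
    then have hop: "hop e (qs ! h) m" and m: "m \<notin> set qs" using test by auto
    have s1: "s1 = effect w visit s" using True by (simp add: s1_def)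
    note V = visit_queue[OF q regs0(1) _ B(2) j(1,3) m, folded s1]
    have n0: "regs s0 ''n'' = n" using loaded0 by (simp add: loaded_def)
    have "(hop e)\<^sup>*\<^sup>* v m"
      using E h hop nth_mem[OF h] unfolding expanding_def by (meson rtranclp.rtrancl_into_rtrancl)
    then have "expanding B e v s0 (qs @ [m]) h (Suc m) s1"
      using E h V[OF n0] unfolding expanding_def
      by (auto simp: nth_append less_Suc_eq)
    moreover have "regs s1 ''u'' = (qs @ [m]) ! h" "regs s1 ''j'' = m"
      using V(3)[OF n0] j h by (auto simp: nth_append)
    ultimately show ?thesis using h by (intro conjI exI[of _ "qs @ [m]"]) auto
  next
    case False
    then have s1: "s1 = s" by (simp add: s1_def)
    have "expanding B e v s0 qs h (Suc m) s"
      using E test False unfolding expanding_def by (auto simp: less_Suc_eq)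
    then show ?thesis unfolding s1 using h j by blast
  qed
  then obtain qs' where "expanding B e v s0 qs' h (Suc m) s1" "h < length qs'"
    "regs s1 ''u'' = qs' ! h" "regs s1 ''j'' = m" by blast
  then show "\<exists>qs'. expanding B e v s0 qs' h (Suc m) s' \<and> h < length qs' \<and> regs s' ''u'' = qs' ! h"
    "regs s' ''j'' = Suc m"
    using next_if \<open>Suc m < 2 ^ w\<close> by (auto simp: s')
qed

lemma halts_expand:
  assumes E: "expanding B e v s0 qs h 0 s" and h: "h < length qs"
  shows "halts w expand (200 * (n + 1)) (\<lambda>s'. \<exists>qs'. expanding B e v s0 qs' (Suc h) 0 s') s"
proof -
  note regs = expanding_regs[OF E]
  define Inv where "Inv = (\<lambda>s. \<exists>qs m. m \<le> n \<and> expanding B e v s0 qs h m s \<and> h < length qs \<and>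
    regs s ''j'' = m \<and> regs s ''u'' = qs ! h)"
  let ?body = "Seq (Cond visit_test visit Skip) (Assign ''j'' (Plus (Reg ''j'') (Const 1)))"
  let ?\<mu> = "\<lambda>s. n - regs s ''j''"
  have hn: "h < n" using h queue_length(1)[of B qs s] E by (auto simp: expanding_def)
  have init: "halts w (Seq (Assign ''u'' (Read (Plus (Plus (Reg ''base'') (Reg ''n'')) (Reg ''h''))))
              (Assign ''j'' (Const 0))) 20 Inv s"
  proof (rule halts_loop_free)
    have "B + n < 2 ^ w" "B + n + h < 2 ^ w" using B hn by (auto intro!: word_less)
    then show "Inv (effect w (Seq (Assign ''u'' (Read (Plus (Plus (Reg ''base'') (Reg ''n'')) (Reg ''h''))))
              (Assign ''j'' (Const 0))) s)"
      unfolding Inv_def using E h regs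
      by (intro exI[of _ qs] exI[of _ 0]) (auto simp: expanding_def queue_def frame_def)
  qed simp_all
  have loop: "halts w (Loop (Less (Reg ''j'') (Reg ''n'')) ?body) (n * 150 + 4)
      (\<lambda>s. \<exists>qs. expanding B e v s0 qs h n s \<and> h < length qs) s1" if "Inv s1" for s1
  proof (rule halts_mono)
    show "halts w (Loop (Less (Reg ''j'') (Reg ''n'')) ?body)
      (?\<mu> s1 * (1 + bcost (Less (Reg ''j'') (Reg ''n'')) + 120) + (1 + bcost (Less (Reg ''j'') (Reg ''n''))))
      (\<lambda>s. Inv s \<and> \<not> bval w (Less (Reg ''j'') (Reg ''n'')) s) s1"
    proof (rule halts_Loop[where \<mu> = ?\<mu>])
      show "Inv s1" by (rule that)
      fix s assume "Inv s" and less: "bval w (Less (Reg ''j'') (Reg ''n'')) s"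
      then obtain qs m where qs: "expanding B e v s0 qs h m s" "h < length qs"
        "regs s ''j'' = m" "regs s ''u'' = qs ! h" unfolding Inv_def by blast
      have "m < n" using less qs(3) expanding_regs[OF qs(1)] by simp
      note step = expand_inner_step[OF qs this]
      show "halts w ?body 120 (\<lambda>s'. Inv s' \<and> ?\<mu> s' < ?\<mu> s) s"
      proof (rule halts_loop_free)
        show "Inv (effect w ?body s) \<and> ?\<mu> (effect w ?body s) < ?\<mu> s"
          using step \<open>m < n\<close> qs(3) unfolding Inv_def by (metis Suc_leI diff_less_mono2 lessI)
      qed (simp_all add: visit_test_def visit_def arc_test_def pref_test_def rank_at_def square_n_def)
    qed
    show "?\<mu> s1 * (1 + bcost (Less (Reg ''j'') (Reg ''n'')) + 120) +
        (1 + bcost (Less (Reg ''j'') (Reg ''n''))) \<le> n * 150 + 4" by simp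
    fix s assume s: "Inv s \<and> \<not> bval w (Less (Reg ''j'') (Reg ''n'')) s"
    then obtain qs m where qs: "m \<le> n" "expanding B e v s0 qs h m s" "h < length qs"
        "regs s ''j'' = m" unfolding Inv_def by blast
    then have "m = n" using s expanding_regs(3)[OF qs(2)] by simp
    then show "\<exists>qs. expanding B e v s0 qs h n s \<and> h < length qs" using qs by blast
  qed
  have last: "halts w (Assign ''h'' (Plus (Reg ''h'') (Const 1))) 4
      (\<lambda>s'. \<exists>qs'. expanding B e v s0 qs' (Suc h) 0 s') s1"
    if ex: "\<exists>qs. expanding B e v s0 qs h n s1 \<and> h < length qs" for s1
  proof (rule halts_loop_free)
    obtain qs where qs: "expanding B e v s0 qs h n s1" "h < length qs" using ex by blast
    have "Suc h < 2 ^ w" using hn by (auto intro!: word_less)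
    \<comment> \<open>Targets of \<open>hop\<close> lie below \<open>n\<close>, so having treated
      all vertices below \<open>n\<close> covers every arc.\<close>
    moreover have "\<forall>y. hop e (qs ! h) y \<longrightarrow> y \<in> set qs"
      using qs(1) by (auto simp: expanding_def hop_def)
    \<comment> \<open>With \<open>0\<close> in place of \<open>m\<close> the last clause of
      \<open>expanding\<close> is vacuous, which matters when \<open>Suc h = length qs\<close> and
      no such entry exists.\<close>
    ultimately have "expanding B e v s0 qs (Suc h) 0 (effect w (Assign ''h'' (Plus (Reg ''h'') (Const 1))) s1)"
      using qs by (auto simp: expanding_def queue_def frame_def less_Suc_eq)
    then show "\<exists>qs'. expanding B e v s0 qs' (Suc h) 0 (effect w (Assign ''h'' (Plus (Reg ''h'') (Const 1))) s1)"
      by blast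
  qed simp_all
  have "halts w expand (20 + ((n * 150 + 4) + 4)) (\<lambda>s'. \<exists>qs'. expanding B e v s0 qs' (Suc h) 0 s') s"
    unfolding expand_def by (rule halts_Seq[OF init halts_Seq[OF loop last]])
  then show ?thesis by (rule halts_mono) auto
qed

text \<open>On exit \<open>h = length qs\<close>, so the marked set contains \<open>v\<close>, is
  closed under \<open>hop e\<close> and consists of reachable vertices. At most \<open>n\<close>
  entries are expanded, each in linear time, whence the quadratic bound.\<close>

lemma halts_search:
  assumes zero: "\<forall>p. B \<le> p \<longrightarrow> p < B + 2 * n \<longrightarrow> mem s0 p = 0"
  shows "halts w search (300 * (n + 1) ^ 2)
    (\<lambda>s. frame B s0 s \<and> (\<forall>j<n. mem s (B + j) = (if (hop e)\<^sup>*\<^sup>* v j then 1 else 0))) s0"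
proof -
  define Inv where "Inv = (\<lambda>s. \<exists>qs h. expanding B e v s0 qs h 0 s)"
  let ?init = "Seq (Assign ''h'' (Const 0))
         (Seq (Assign ''t'' (Const 1))
         (Seq (Write (Plus (Reg ''base'') (Reg ''src'')) (Const 1))
              (Write (Plus (Reg ''base'') (Reg ''n'')) (Reg ''src''))))"
  let ?less = "Less (Reg ''h'') (Reg ''t'')"
  let ?\<mu> = "\<lambda>s. n - regs s ''h''"
  have init: "halts w ?init 20 (\<lambda>s. Inv s \<and> ?\<mu> s \<le> n) s0"
  proof (rule halts_loop_free)
    have "B + v < 2 ^ w" "B + n < 2 ^ w" using B v by (auto intro!: word_less)
    moreover have "regs s0 ''n'' = n" using loaded0 by (simp add: loaded_def)
    ultimately have eff: "effect w ?init s0 = s0\<lparr>regs := (regs s0)(''h'' := 0, ''t'' := 1),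
        mem := (mem s0)(B + v := 1, B + n := v)\<rparr>"
      using regs0 by simp
    have "expanding B e v s0 [v] 0 0 (effect w ?init s0)"
      unfolding eff expanding_def queue_def frame_def using v zero by auto
    then show "Inv (effect w ?init s0) \<and> ?\<mu> (effect w ?init s0) \<le> n" unfolding Inv_def by auto
  qed simp_all
  have loop: "halts w (Loop ?less expand) (n * (4 + 200 * (n + 1)) + 4)
    (\<lambda>s. frame B s0 s \<and> (\<forall>j<n. mem s (B + j) = (if (hop e)\<^sup>*\<^sup>* v j then 1 else 0))) s"
    if s: "Inv s \<and> ?\<mu> s \<le> n" for s
  proof (rule halts_mono)
    show "halts w (Loop ?less expand) (?\<mu> s * (1 + bcost ?less + 200 * (n + 1)) + (1 + bcost ?less))
      (\<lambda>s. Inv s \<and> \<not> bval w ?less s) s"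
    proof (rule halts_Loop[where \<mu> = ?\<mu>])
      show "Inv s" using s by blast
      fix s assume "Inv s" and less: "bval w ?less s"
      then obtain qs h where E: "expanding B e v s0 qs h 0 s" unfolding Inv_def by blast
      note regs = expanding_regs[OF E]
      have h: "h < length qs" using less regs by simp
      then have hn: "h < n" using queue_length(1)[of B qs s] E by (auto simp: expanding_def)
      show "halts w expand (200 * (n + 1)) (\<lambda>s'. Inv s' \<and> ?\<mu> s' < ?\<mu> s) s"
      proof (rule halts_mono[OF halts_expand[OF E h]])
        fix s' assume "\<exists>qs'. expanding B e v s0 qs' (Suc h) 0 s'"
        then show "Inv s' \<and> ?\<mu> s' < ?\<mu> s"
          using hn regs(6) expanding_regs(6) unfolding Inv_def by (metis diff_less_mono2 lessI)
      qed simp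
    qed
    show "?\<mu> s * (1 + bcost ?less + 200 * (n + 1)) + (1 + bcost ?less) \<le> n * (4 + 200 * (n + 1)) + 4"
      using s by (intro add_mono mult_mono) auto
    fix s assume s: "Inv s \<and> \<not> bval w ?less s"
    then obtain qs h where E: "expanding B e v s0 qs h 0 s" unfolding Inv_def by blast
    have "h = length qs" using s E expanding_regs[OF E] by (auto simp: expanding_def)
    then have closed: "y \<in> set qs" if "x \<in> set qs" "hop e x y" for x y
      using that E by (auto simp: expanding_def in_set_conv_nth)
    have "y \<in> set qs" if "(hop e)\<^sup>*\<^sup>* v y" for y
      using that
    proof (induction rule: rtranclp_induct)
      case base
      then show ?case using E by (simp add: expanding_def)
    qed (rule closed)
    then have "(hop e)\<^sup>*\<^sup>* v y \<longleftrightarrow> y \<in> set qs" for y using E by (auto simp: expanding_def)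
    then show "frame B s0 s \<and> (\<forall>j<n. mem s (B + j) = (if (hop e)\<^sup>*\<^sup>* v j then 1 else 0))"
      using E by (auto simp: expanding_def queue_def)
  qed
  have "halts w search (20 + (n * (4 + 200 * (n + 1)) + 4))
    (\<lambda>s. frame B s0 s \<and> (\<forall>j<n. mem s (B + j) = (if (hop e)\<^sup>*\<^sup>* v j then 1 else 0))) s0"
    unfolding search_def by (rule halts_Seq[OF init loop])
  then show ?thesis
    by (rule halts_mono) (auto simp: power2_eq_square algebra_simps)
qed

end

subsection \<open>Finding the center and the intermediate object\<close>

text \<open>The register need not equal \<open>c\<close>, since with two agents both are centers;
  hence the conclusion asserts \<open>star_market\<close> for its value.\<close>

lemma halts_find_center:
  assumes n0: "regs s0 ''n'' = n" and row: "\<forall>j<n. mem s0 j = (if {0, j} \<in> edges I then 1 else 0)"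
  shows "halts w find_center (40 * (n + 1))
    (\<lambda>s. mem s = mem s0 \<and> (\<forall>x. x \<notin> {''c'', ''i''} \<longrightarrow> regs s x = regs s0 x) \<and>
      star_market I (regs s ''c'')) s0"
proof -
  define Inv where "Inv = (\<lambda>s :: state. mem s = mem s0 \<and> (\<forall>x. x \<notin> {''c'', ''i''} \<longrightarrow> regs s x = regs s0 x) \<and>
    regs s ''i'' \<le> n \<and>
    (regs s ''c'' = 0 \<and> (\<forall>j<regs s ''i''. {0, j} \<notin> edges I) \<or>
     regs s ''c'' < n \<and> {0, regs s ''c''} \<in> edges I))"
  let ?less = "Less (Reg ''i'') (Reg ''n'')"
  let ?body = "Seq (Cond (Equal (Read (Reg ''i'')) (Const 1)) (Assign ''c'' (Reg ''i'')) Skip)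
            (Assign ''i'' (Plus (Reg ''i'') (Const 1)))"
  let ?test = "Conj (Less (Const 2) (Reg ''n''))
             (Conj (Equal (Read (Const 1)) (Const 1)) (Equal (Read (Const 2)) (Const 1)))"
  let ?fix = "Cond ?test (Assign ''c'' (Const 0)) Skip"
  let ?\<mu> = "\<lambda>s. n - regs s ''i''"
  have init: "halts w (Seq (Assign ''c'' (Const 0)) (Assign ''i'' (Const 0))) 4 Inv s0"
    by (rule halts_loop_free) (auto simp: Inv_def)
  have loop: "halts w (Loop ?less ?body) (n * 20 + 4) (\<lambda>s. Inv s \<and> regs s ''i'' = n) s" if "Inv s" for s
  proof (rule halts_mono)
    show "halts w (Loop ?less ?body) (?\<mu> s * (1 + bcost ?less + 16) + (1 + bcost ?less))
      (\<lambda>s. Inv s \<and> \<not> bval w ?less s) s"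
    proof (rule halts_Loop[where \<mu> = ?\<mu>])
      show "Inv s" by (rule that)
      fix s assume I: "Inv s" and less: "bval w ?less s"
      have i: "regs s ''i'' < n" using less I n0 by (simp add: Inv_def)
      then have "Suc (regs s ''i'') < 2 ^ w" by (intro word_less) simp
      then show "halts w ?body 16 (\<lambda>s'. Inv s' \<and> ?\<mu> s' < ?\<mu> s) s"
        by (intro halts_loop_free) (use I i row in \<open>auto simp: Inv_def less_Suc_eq\<close>)
    qed
    show "?\<mu> s * (1 + bcost ?less + 16) + (1 + bcost ?less) \<le> n * 20 + 4" by simp
    fix s assume s: "Inv s \<and> \<not> bval w ?less s"
    then have "regs s ''n'' = n" "regs s ''i'' \<le> n" using n0 by (simp_all add: Inv_def)
    then show "Inv s \<and> regs s ''i'' = n" using s by simp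
  qed
  have correct: "halts w ?fix 20 (\<lambda>s. mem s = mem s0 \<and> (\<forall>x. x \<notin> {''c'', ''i''} \<longrightarrow> regs s x = regs s0 x) \<and>
      star_market I (regs s ''c'')) s" if s: "Inv s \<and> regs s ''i'' = n" for s
  proof (rule halts_loop_free)
    let ?d = "regs s ''c''"
    have mem: "mem s = mem s0" and regs: "x \<notin> {''c'', ''i''} \<Longrightarrow> regs s x = regs s0 x" for x
      using s unfolding Inv_def by blast+
    have test: "bval w ?test s \<longleftrightarrow> 2 < n \<and> {0, 1} \<in> edges I \<and> {0, 2} \<in> edges I"
      using mem regs[of "''n''"] n0 row[THEN spec, of 1] row[THEN spec, of 2]
      by (auto split: if_splits)
    \<comment> \<open>Agent \<open>0\<close> is adjacent to all others if it is the center, and only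
      to the center otherwise.\<close>
    have edge0: "{0, j} \<in> edges I \<longleftrightarrow> j < n \<and> j \<noteq> 0 \<and> (c = 0 \<or> c = j)" for j
      using center by (auto simp: star doubleton_eq_iff)
    show "mem (effect w ?fix s) = mem s0 \<and>
        (\<forall>x. x \<notin> {''c'', ''i''} \<longrightarrow> regs (effect w ?fix s) x = regs s0 x) \<and>
        star_market I (regs (effect w ?fix s) ''c'')"
    proof (cases "2 < n \<and> {0, 1} \<in> edges I \<and> {0, 2} \<in> edges I")
      case True
      then have "c = 0" by (auto simp: edge0)
      then have "star_market I 0" using star_market_axioms by simp
      moreover have "effect w ?fix s = s\<lparr>regs := (regs s)(''c'' := 0)\<rparr>"
        using True test unfolding effect.simps by simp
      ultimately show ?thesis using mem regs by simp
    next
      case False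
      have d: "?d = 0 \<and> (\<forall>j<n. {0, j} \<notin> edges I) \<or> ?d < n \<and> {0, ?d} \<in> edges I"
        using s unfolding Inv_def by metis
      have "star_market I ?d"
      proof (cases "?d = c")
        case True
        then show ?thesis using star_market_axioms by simp
      next
        case neq: False
        \<comment> \<open>If \<open>c\<close> were not \<open>0\<close>, its edge to
          \<open>0\<close> would be the only one at \<open>0\<close>, forcing \<open>?d = c\<close>.
          With \<open>c = 0\<close>, the failed test leaves at most two agents.\<close>
        have "c = 0" using d neq center by (auto simp: edge0)
        moreover from this have "n \<le> 2" using False by (auto simp: edge0)
        moreover have "?d < n" "?d \<noteq> 0" using d neq \<open>c = 0\<close> by (auto simp: edge0)
        ultimately have "n = 2" "?d = 1" "c = 0" by auto
        then have "edges I = {{?d, i} | i. i < n \<and> i \<noteq> ?d}"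
          unfolding star by (auto simp: less_2_cases_iff doubleton_eq_iff)
        then show ?thesis using weak \<open>?d < n\<close> by unfold_locales
      qed
      moreover have "effect w ?fix s = s"
        using False by (simp only: effect.simps test if_False)
      ultimately show ?thesis using mem regs by simp
    qed
  qed simp_all
  have "halts w find_center (4 + ((n * 20 + 4) + 20)) (\<lambda>s. mem s = mem s0 \<and>
      (\<forall>x. x \<notin> {''c'', ''i''} \<longrightarrow> regs s x = regs s0 x) \<and> star_market I (regs s ''c'')) s0"
    unfolding find_center_def by (rule halts_Seq[OF init halts_Seq[OF loop correct]])
  then show ?thesis by (rule halts_mono) auto
qed

definition witness :: "nat \<Rightarrow> nat \<Rightarrow> nat \<Rightarrow> bool" where
  "witness k a z \<longleftrightarrow> (hop k)\<^sup>*\<^sup>* c z \<and> arc z k \<and> (z, a) \<in> pref I c \<and> (a, z) \<in> pref I k"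

lemma witness_less: "witness k a z \<Longrightarrow> z < n"
  using hop_less center by (auto simp: witness_def)

lemma halts_find_witness:
  assumes s0: "loaded s0" "regs s0 ''agent'' = k" "k < n" "regs s0 ''object'' = a" "a < n"
      "regs s0 ''mark'' = M" "M + n \<le> 2 * n * n + 4 * n"
    and marks: "\<forall>j<n. mem s0 (M + j) = (if (hop k)\<^sup>*\<^sup>* c j then 1 else 0)"
  shows "halts w find_witness (200 * (n + 1))
    (\<lambda>s. mem s = mem s0 \<and> (\<forall>x. x \<notin> {''i'', ''found''} \<longrightarrow> regs s x = regs s0 x) \<and>
      regs s ''found'' = (if \<exists>z. witness k a z then 1 else 0)) s0"
proof -
  define Inv where "Inv = (\<lambda>s :: state. mem s = mem s0 \<and>
    (\<forall>x. x \<notin> {''i'', ''found''} \<longrightarrow> regs s x = regs s0 x) \<and> regs s ''i'' \<le> n \<and>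
    regs s ''found'' = (if \<exists>z<regs s ''i''. witness k a z then 1 else 0))"
  let ?less = "Less (Reg ''i'') (Reg ''n'')"
  let ?body = "Seq (Cond witness_test (Assign ''found'' (Const 1)) Skip)
            (Assign ''i'' (Plus (Reg ''i'') (Const 1)))"
  let ?\<mu> = "\<lambda>s. n - regs s ''i''"
  have n0: "regs s0 ''n'' = n" using s0(1) by (simp add: loaded_def)
  have init: "halts w (Seq (Assign ''i'' (Const 0)) (Assign ''found'' (Const 0))) 4 Inv s0"
    by (rule halts_loop_free) (auto simp: Inv_def)
  have loop: "halts w (Loop ?less ?body) (n * 150 + 4) (\<lambda>s. Inv s \<and> regs s ''i'' = n) s" if "Inv s" for s
  proof (rule halts_mono)
    show "halts w (Loop ?less ?body) (?\<mu> s * (1 + bcost ?less + 130) + (1 + bcost ?less))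
      (\<lambda>s. Inv s \<and> \<not> bval w ?less s) s"
    proof (rule halts_Loop[where \<mu> = ?\<mu>])
      show "Inv s" by (rule that)
      fix s assume I: "Inv s" and less: "bval w ?less s"
      have i: "regs s ''i'' < n" using less I n0 by (simp add: Inv_def)
      then have bound: "Suc (regs s ''i'') < 2 ^ w" "M + regs s ''i'' < 2 ^ w"
        using s0(7) by (auto intro!: word_less)
      have "loaded s" using I s0(1) by (simp add: loaded_def Inv_def)
      then have test: "bval w witness_test s \<longleftrightarrow> witness k a (regs s ''i'')"
        using I s0 i bound marks center
        by (auto simp: witness_test_def bval_arc_test bval_pref_test witness_def Inv_def loaded_def)
      show "halts w ?body 130 (\<lambda>s'. Inv s' \<and> ?\<mu> s' < ?\<mu> s) s"
      proof (rule halts_loop_free)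
        show "Inv (effect w ?body s) \<and> ?\<mu> (effect w ?body s) < ?\<mu> s"
        proof -
          have "effect w ?body s = s\<lparr>regs := (regs s)
              (''found'' := if witness k a (regs s ''i'') then 1 else regs s ''found'',
               ''i'' := Suc (regs s ''i''))\<rparr>"
            using test bound(1) by (auto simp: fun_upd_idem)
          moreover have "(\<exists>z<Suc (regs s ''i''). witness k a z) \<longleftrightarrow>
              witness k a (regs s ''i'') \<or> (\<exists>z<regs s ''i''. witness k a z)"
            by (auto simp: less_Suc_eq)
          ultimately show ?thesis using I i by (simp add: Inv_def diff_less_mono2)
        qed
      qed (simp_all add: witness_test_def arc_test_def pref_test_def rank_at_def square_n_def)
    qed
    show "?\<mu> s * (1 + bcost ?less + 130) + (1 + bcost ?less) \<le> n * 150 + 4" by simp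
    fix s assume s: "Inv s \<and> \<not> bval w ?less s"
    then have "regs s ''n'' = n" "regs s ''i'' \<le> n" using n0 by (simp_all add: Inv_def)
    then show "Inv s \<and> regs s ''i'' = n" using s by simp
  qed
  have "halts w find_witness (4 + (n * 150 + 4)) (\<lambda>s. Inv s \<and> regs s ''i'' = n) s0"
    unfolding find_witness_def by (rule halts_Seq[OF init loop])
  \<comment> \<open>Every witness is an object below \<open>n\<close>, so the scan is
    exhaustive.\<close>
  moreover have "(\<exists>z<n. witness k a z) \<longleftrightarrow> (\<exists>z. witness k a z)" using witness_less by blast
  ultimately show ?thesis by (elim halts_mono) (simp_all add: Inv_def)
qed

lemma conclude_answer:
  assumes s: "loaded s" "regs s ''agent'' = k" "k < n" "regs s ''object'' = a" "a < n"
      "regs s ''mark'' = M" "M + n \<le> 2 * n * n + 4 * n"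
      "regs s ''base'' = B" "B + n \<le> 2 * n * n + 4 * n"
    and marks: "mem s (M + a) = (if (hop k)\<^sup>*\<^sup>* c a then 1 else 0)"
      "mem s (B + a) = (if (hop c)\<^sup>*\<^sup>* k a then 1 else 0)"
      "regs s ''found'' = (if \<exists>z. witness k a z then 1 else 0)"
  shows "regs (effect w conclude s) ''answer'' = (if reachable I k a then 1 else 0)"
proof -
  have "M + a < 2 ^ w" "B + a < 2 ^ w" using s by (auto intro!: word_less)
  moreover have "regs s ''c'' = c" using s(1) by (simp add: loaded_def)
  moreover have "bval w (arc_test (Reg ''object'') (Reg ''agent'')) s \<longleftrightarrow> arc a k"
    using s by (simp add: bval_arc_test)
  ultimately show ?thesis
    using s marks unfolding reachable_iff_obtainable[OF s(3)] obtainable_def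
    by (auto simp: conclude_def witness_def)
qed

section \<open>Composition of the phases and the quadratic bound\<close>

text \<open>The searches work in disjoint blocks of \<open>2 * n\<close> cells at \<open>?M\<close>
  and \<open>?B\<close>. The frame of the first keeps the second block zero, and the frame of the
  second keeps the first marks.\<close>

lemma halts_after_center:
  assumes s0: "mem s0 = input_mem I" "regs s0 ''n'' = n" "regs s0 ''c'' = c"
    "regs s0 ''agent'' = k" "k < n" "regs s0 ''object'' = a" "a < n"
  shows "halts w (Seq first_input (Seq search (Seq second_input (Seq search
       (Seq find_witness conclude))))) (1100 * (n + 1) ^ 2)
    (\<lambda>s. regs s ''answer'' = (if reachable I k a then 1 else 0)) s0"
proof -
  let ?M = "2 * n * n" and ?B = "2 * n * n + 2 * n"
  let ?marked = "\<lambda>(s :: state) B e v. \<forall>j<n. mem s (B + j) = (if (hop e)\<^sup>*\<^sup>* v j then 1 else 0 :: nat)"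
  define query where "query = (\<lambda>s. loaded s \<and> regs s ''agent'' = k \<and> regs s ''object'' = a \<and>
    regs s ''mark'' = ?M)"
  define zero where "zero = (\<lambda>(s :: state) B. \<forall>p. B \<le> p \<longrightarrow> mem s p = 0)"
  have "n * n + n * n < 2 ^ w" "?M + (n + n) < 2 ^ w" "n + n < 2 ^ w" by (auto intro!: word_less)
  note bound = this[simplified]
  have 1: "halts w first_input 20 (\<lambda>s. query s \<and> zero s ?M \<and>
      regs s ''base'' = ?M \<and> regs s ''src'' = c \<and> regs s ''ex'' = k) s0"
    using s0 bound aval_square_n[OF s0(2)]
    by (intro halts_loop_free)
      (auto simp: first_input_def query_def zero_def loaded_def square_n_def input_mem_def Let_def)
  have 2: "halts w search (300 * (n + 1) ^ 2) (\<lambda>s'. query s' \<and> zero s' ?B \<and> ?marked s' ?M k c) s"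
    if s: "query s \<and> zero s ?M \<and> regs s ''base'' = ?M \<and> regs s ''src'' = c \<and> regs s ''ex'' = k" for s
  proof (rule halts_mono[OF halts_search[of s ?M k c]])
    fix s' assume s': "frame ?M s s' \<and> ?marked s' ?M k c"
    then have "loaded s'" using s frame_loaded[of ?M s s'] by (auto simp: query_def)
    then show "query s' \<and> zero s' ?B \<and> ?marked s' ?M k c"
      using s s' by (auto simp: query_def zero_def frame_def)
  qed (use s center in \<open>auto simp: query_def zero_def\<close>)
  have 3: "halts w second_input 20 (\<lambda>s'. query s' \<and> zero s' ?B \<and> ?marked s' ?M k c \<and>
      regs s' ''base'' = ?B \<and> regs s' ''src'' = k \<and> regs s' ''ex'' = c) s"
    if s: "query s \<and> zero s ?B \<and> ?marked s ?M k c" for s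
    using s bound by (intro halts_loop_free) (auto simp: second_input_def query_def zero_def loaded_def)
  have 4: "halts w search (300 * (n + 1) ^ 2) (\<lambda>s'. query s' \<and> regs s' ''base'' = ?B \<and>
      ?marked s' ?M k c \<and> ?marked s' ?B c k) s"
    if s: "query s \<and> zero s ?B \<and> ?marked s ?M k c \<and>
      regs s ''base'' = ?B \<and> regs s ''src'' = k \<and> regs s ''ex'' = c" for s
  proof (rule halts_mono[OF halts_search[of s ?B c k]])
    fix s' assume s': "frame ?B s s' \<and> ?marked s' ?B c k"
    then have "loaded s'" using s frame_loaded[of ?B s s'] by (auto simp: query_def)
    moreover have "mem s' (?M + j) = mem s (?M + j)" if "j < n" for j
      using s' that by (auto simp: frame_def)
    ultimately show "query s' \<and> regs s' ''base'' = ?B \<and> ?marked s' ?M k c \<and> ?marked s' ?B c k"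
      using s s' by (auto simp: query_def frame_def)
  qed (use s s0 in \<open>auto simp: query_def zero_def\<close>)
  have 5: "halts w find_witness (200 * (n + 1)) (\<lambda>s'. query s' \<and> regs s' ''base'' = ?B \<and>
      ?marked s' ?M k c \<and> ?marked s' ?B c k \<and>
      regs s' ''found'' = (if \<exists>z. witness k a z then 1 else 0)) s"
    if s: "query s \<and> regs s ''base'' = ?B \<and> ?marked s ?M k c \<and> ?marked s ?B c k" for s
    by (rule halts_mono[OF halts_find_witness[of s k a ?M]])
      (use s s0 in \<open>auto simp: query_def loaded_def\<close>)
  have 6: "halts w conclude 200 (\<lambda>s. regs s ''answer'' = (if reachable I k a then 1 else 0)) s"
    if s: "query s \<and> regs s ''base'' = ?B \<and> ?marked s ?M k c \<and> ?marked s ?B c k \<and>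
      regs s ''found'' = (if \<exists>z. witness k a z then 1 else 0)" for s
  proof (rule halts_loop_free)
    show "regs (effect w conclude s) ''answer'' = (if reachable I k a then 1 else 0)"
      by (rule conclude_answer[of s k a ?M ?B]) (use s s0 in \<open>auto simp: query_def\<close>)
  qed (simp_all add: conclude_def arc_test_def pref_test_def rank_at_def square_n_def)
  show ?thesis
    by (rule halts_mono[OF halts_Seq[OF 1 halts_Seq[OF 2 halts_Seq[OF 3 halts_Seq[OF 4
      halts_Seq[OF 5 6]]]]]]) (auto simp: power2_eq_square algebra_simps)
qed

end

lemma halts_reach_prog:
  assumes "weak_preferences I" "star_network I" "k < size_of I" "a < size_of I"
    "(size_of I + 1) ^ 4 \<le> 2 ^ w"
  shows "halts w reach_prog (1200 * (size_of I + 1) ^ 2)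
    (\<lambda>s. regs s ''answer'' = (if reachable I k a then 1 else 0)) (input_state I k a)"
proof -
  let ?n = "size_of I" and ?s = "input_state I k a"
  obtain c where "c < ?n" "edges I = {{c, i} | i. i < ?n \<and> i \<noteq> c}"
    using assms(2) unfolding star_network_def by blast
  then interpret star_ram I c w using assms by unfold_locales
  have "mem ?s j = (if {0, j} \<in> edges I then 1 else 0)" if "j < ?n" for j
    using that row_index_less[of 0 ?n j] by (simp add: input_state_def input_mem_def Let_def)
  then have center: "halts w find_center (40 * (?n + 1))
    (\<lambda>s. mem s = mem ?s \<and> (\<forall>x. x \<notin> {''c'', ''i''} \<longrightarrow> regs s x = regs ?s x) \<and>
      star_market I (regs s ''c'')) ?s"
    by (intro halts_find_center) (auto simp: input_state_def)
  show ?thesis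
    unfolding reach_prog_def
  proof (rule halts_mono[OF halts_Seq[OF center]])
    fix s :: state assume s: "mem s = mem ?s \<and> (\<forall>x. x \<notin> {''c'', ''i''} \<longrightarrow> regs s x = regs ?s x) \<and>
      star_market I (regs s ''c'')"
    \<comment> \<open>The center found may differ from the \<open>c\<close> chosen above, so the
      analysis of the remaining phases is instantiated with it.\<close>
    then interpret found: star_ram I "regs s ''c''" w
      using assms(5) by (simp add: star_ram_def star_ram_axioms_def)
    show "halts w (Seq first_input (Seq search (Seq second_input (Seq search
       (Seq find_witness conclude))))) (1100 * (?n + 1) ^ 2)
      (\<lambda>s. regs s ''answer'' = (if reachable I k a then 1 else 0)) s"
      by (rule found.halts_after_center) (use s assms in \<open>auto simp: input_state_def\<close>)
  qed (auto simp: power2_eq_square algebra_simps)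
qed

theorem theorem5:
  shows "\<exists>(P :: prog) (d :: nat) (T :: nat \<Rightarrow> nat).
    (\<lambda>n. real (T n)) \<in> O(\<lambda>n. real n ^ 2) \<and>
    (\<forall>I k a w. weak_preferences I \<longrightarrow> star_network I \<longrightarrow>
       k < size_of I \<longrightarrow> a < size_of I \<longrightarrow> (size_of I + 1) ^ d \<le> 2 ^ w \<longrightarrow>
       (\<exists>t s. exec w P (input_state I k a) t s \<and> t \<le> T (size_of I) \<and>
          regs s ''answer'' = (if reachable I k a then 1 else 0)))"
proof (intro exI conjI)
  let ?T = "\<lambda>n::nat. 1200 * (n + 1) ^ 2"
  have "real (?T n) \<le> 4800 * real n ^ 2" if "1 \<le> n" for n
  proof -
    \<comment> \<open>For positive \<open>n\<close>, \<open>n + 1 \<le> 2 * n\<close>; squaring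
      contributes the factor 4 in \<open>4800\<close>.\<close>
    have "(n + 1) ^ 2 \<le> (2 * n) ^ 2" using that by (intro power_mono) auto
    then have "?T n \<le> 4800 * n ^ 2" by (simp add: power_mult_distrib)
    then have "real (?T n) \<le> real (4800 * n ^ 2)" by (rule of_nat_mono)
    then show ?thesis by simp
  qed
  then show "(\<lambda>n. real (?T n)) \<in> O(\<lambda>n. real n ^ 2)"
    by (intro bigoI[where c = 4800] eventually_sequentiallyI[of 1]) simp
  \<comment> \<open>Here \<open>d\<close> becomes 4, the exponent for which all addresses fit into a
    word.\<close>
  show "\<forall>I k a w. weak_preferences I \<longrightarrow> star_network I \<longrightarrow>
       k < size_of I \<longrightarrow> a < size_of I \<longrightarrow> (size_of I + 1) ^ 4 \<le> 2 ^ w \<longrightarrow>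
       (\<exists>t s. exec w reach_prog (input_state I k a) t s \<and> t \<le> ?T (size_of I) \<and>
          regs s ''answer'' = (if reachable I k a then 1 else 0))"
    using halts_reach_prog unfolding halts_def by blast
qed

end
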